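(* Let $F\in\mathbb{R}[x]$ be a polynomial of degree at least $1$ and let $L$ be the Liénard vector field on $\mathbb{R}^2$ corresponding to the system $$\dot{x}=y-F(x),\qquad \dot{y}=-x.$$ Suppose that $L$ has at least one closed orbit. If $X$ is a polynomial vector field on $\mathbb{R}^2$ such that $[L,X]\equiv 0$, then $X=cL$ for some constant $c\in\mathbb{R}$.
   Context: $[\cdot,\cdot]$ denotes the Lie bracket of vector fields. A closed orbit is a non-constant periodic orbit. *)

theory Defs
  imports "HOL-Analysis.Analysis" "HOL-Computational_Algebra.Polynomial"
begin

(* frechet_derivative is arbitrary at points of non-differentiability; this is
   the Lie bracket DW(V) - DV(W) for differentiable fields. *)
definition lie_bracket ::
    "('a::real_normed_vector \<Rightarrow> 'a) \<Rightarrow> ('a \<Rightarrow> 'a) \<Rightarrow> 'a \<Rightarrow> 'a" where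
  "lie_bracket V W p =
     frechet_derivative W (at p) (V p) - frechet_derivative V (at p) (W p)"

definition integral_curve ::
    "('a::real_normed_vector \<Rightarrow> 'a) \<Rightarrow> (real \<Rightarrow> 'a) \<Rightarrow> bool" where
  "integral_curve V \<gamma> \<longleftrightarrow> (\<forall>t. (\<gamma> has_vector_derivative V (\<gamma> t)) (at t))"

definition closed_orbit ::
    "('a::real_normed_vector \<Rightarrow> 'a) \<Rightarrow> 'a set \<Rightarrow> bool" where
  "closed_orbit V S \<longleftrightarrow>
     (\<exists>\<gamma> T. integral_curve V \<gamma> \<and> T > 0 \<and> (\<forall>t. \<gamma> (t + T) = \<gamma> t)
        \<and> \<not> \<gamma> constant_on UNIV \<and> S = range \<gamma>)"

definition lienard :: "real poly \<Rightarrow> real \<times> real \<Rightarrow> real \<times> real" where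
  "lienard F = (\<lambda>(x, y). (y - poly F x, - x))"

end

theory Submission
  imports Defs
begin

text \<open>
  Write \<open>X = (P, Q)\<close>. The relation \<open>[L, X] = 0\<close> gives \<open>P = - L Q\<close> and a second-order linear equation
  for \<open>Q\<close> whose leading term is \<open>(y - F)\<^sup>2 Q\<^sub>x\<^sub>x\<close>. If \<open>n = degree F \<ge> 2\<close>, give \<open>x\<close> weight \<open>1\<close> and
  \<open>y\<close> weight \<open>n\<close>, and let \<open>q\<close> be the component of \<open>Q\<close> of top weight \<open>N\<close>. The terms of
  top weight in the equation force \<open>q\<^sub>x\<^sub>x = 0\<close>, so \<open>q\<close> is a single monomial; along the curve
  \<open>y = F x\<close> the next terms give \<open>(1 - N) q(1, a) = 0\<close>, where \<open>a\<close> is the leading coefficient of \<open>F\<close>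
  (Euler's identity). Hence \<open>N = 1\<close>, \<open>Q\<close> is a multiple of \<open>x\<close>, and \<open>X\<close> is a multiple of \<open>L\<close>.
  The closed orbit is needed only when \<open>n = 1\<close>: for \<open>F = b + a x\<close> the function
  \<open>x\<^sup>2 + (y - b)\<^sup>2\<close> has derivative \<open>- 2 a x\<^sup>2\<close> along solutions, so there is no closed orbit.
\<close>

section \<open>Monomial sums and their growth along curves\<close>

text \<open>Exponents are functions of an abstract index, so differentiation keeps the index set and
  changes only coefficients and exponents. Distinct indices may carry the same monomial.\<close>

definition monomial_sum ::
    "'j set \<Rightarrow> ('j \<Rightarrow> real) \<Rightarrow> ('j \<Rightarrow> nat) \<Rightarrow> ('j \<Rightarrow> nat) \<Rightarrow> real \<Rightarrow> real \<Rightarrow> real" where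
  "monomial_sum S c e f x y = (\<Sum>j\<in>S. c j * x ^ e j * y ^ f j)"

lemma monomial_sum_has_derivative:
  "((\<lambda>p. monomial_sum S c e f (fst p) (snd p)) has_derivative
     (\<lambda>h. fst h * monomial_sum S (\<lambda>j. c j * real (e j)) (\<lambda>j. e j - 1) f (fst p) (snd p)
        + snd h * monomial_sum S (\<lambda>j. c j * real (f j)) e (\<lambda>j. f j - 1) (fst p) (snd p)))
   (at p)"
  unfolding monomial_sum_def
  by (auto intro!: derivative_eq_intros
      simp: sum_distrib_left sum.distrib[symmetric] algebra_simps)

text \<open>Truncated subtraction of exponents is harmless when every monomial with too small an
  exponent has coefficient zero.\<close>

lemma monomial_sum_shift:
  assumes "\<And>j. j \<in> S \<Longrightarrow> c j \<noteq> 0 \<Longrightarrow> a \<le> e j \<and> b \<le> f j"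
  shows "x ^ a * y ^ b * monomial_sum S c (\<lambda>j. e j - a) (\<lambda>j. f j - b) x y = monomial_sum S c e f x y"
proof -
  have "x ^ a * y ^ b * (c j * x ^ (e j - a) * y ^ (f j - b)) = c j * x ^ e j * y ^ f j" if "j \<in> S" for j
  proof (cases "c j = 0")
    case False
    then have "x ^ a * x ^ (e j - a) = x ^ e j" "y ^ b * y ^ (f j - b) = y ^ f j"
      using assms[OF that] by (simp_all flip: power_add)
    then show ?thesis by (metis mult.commute mult.left_commute)
  qed simp
  then show ?thesis
    unfolding monomial_sum_def sum_distrib_left by (intro sum.cong refl)
qed

text \<open>On a curve \<open>y = g s\<close> with \<open>g s\<close> asymptotically
  \<open>\<eta> * s ^ n\<close>, a monomial grows with its weight \<open>e j + n * f j\<close>.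
  Division by \<open>s ^ N\<close> therefore leaves only the component of weight \<open>N\<close>,
  evaluated at \<open>(1, \<eta>)\<close>.\<close>

lemma monomial_sum_tendsto:
  assumes le: "\<And>j. j \<in> S \<Longrightarrow> e j + n * f j \<le> N"
    and g: "((\<lambda>s. g s / s ^ n) \<longlongrightarrow> \<eta>) at_top"
  shows "((\<lambda>s. monomial_sum S c e f s (g s) / s ^ N) \<longlongrightarrow>
      (\<Sum>j\<in>S. if e j + n * f j = N then c j * \<eta> ^ f j else 0)) at_top"
proof -
  have summand: "((\<lambda>s. c j * s ^ e j * g s ^ f j / s ^ N) \<longlongrightarrow>
      (if e j + n * f j = N then c j * \<eta> ^ f j else 0)) at_top" if j: "j \<in> S" for j
  proof -
    \<comment> \<open>The weight deficit: a factor \<open>inverse s ^ d\<close> is left over, which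
      tends to zero unless \<open>d = 0\<close>.\<close>
    define d where "d = N - (e j + n * f j)"
    have N: "N = e j + n * f j + d" using le[OF j] by (simp add: d_def)
    have inv: "((\<lambda>s::real. inverse s ^ d) \<longlongrightarrow> (if d = 0 then 1 else 0)) at_top"
    proof (cases "d = 0")
      case False
      have "((\<lambda>s::real. inverse s ^ d) \<longlongrightarrow> 0 ^ d) at_top"
        by (intro tendsto_power tendsto_inverse_0_at_top filterlim_ident)
      with False show ?thesis by (simp only: power_0_left if_False)
    qed simp
    have "((\<lambda>s. c j * (g s / s ^ n) ^ f j * inverse s ^ d) \<longlongrightarrow>
        c j * \<eta> ^ f j * (if d = 0 then 1 else 0)) at_top"
      by (intro tendsto_intros g inv)
    moreover have "\<forall>\<^sub>F s in at_top. c j * (g s / s ^ n) ^ f j * inverse s ^ d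
        = c j * s ^ e j * g s ^ f j / s ^ N"
      using eventually_gt_at_top[of 0]
    proof eventually_elim
      case (elim s)
      then show ?case
        by (simp add: N power_add power_mult power_divide field_simps)
    qed
    ultimately show ?thesis
      using N by (auto elim: Lim_transform_eventually)
  qed
  show ?thesis
    unfolding monomial_sum_def sum_divide_distrib by (intro tendsto_sum summand)
qed

lemma poly_altdef_le:
  fixes p :: "'a::comm_semiring_1 poly"
  assumes "degree p \<le> n"
  shows "poly p x = (\<Sum>i\<le>n. coeff p i * x ^ i)"
  unfolding poly_altdef using assms
  by (intro sum.mono_neutral_left) (auto simp: coeff_eq_0)

lemma poly_over_power_tendsto:
  fixes p :: "real poly"
  assumes "degree p \<le> n"
  shows "((\<lambda>s. poly p s / s ^ n) \<longlongrightarrow> coeff p n) at_top"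
proof -
  \<comment> \<open>All exponents of \<open>y\<close> are zero, so the curve \<open>y = 0\<close>
    serves, with \<open>0 ^ 0 = 1\<close>.\<close>
  have "((\<lambda>s. monomial_sum {..n} (coeff p) (\<lambda>i. i) (\<lambda>_. 0) s 0 / s ^ n) \<longlongrightarrow>
      (\<Sum>j\<le>n. if j + 0 * 0 = n then coeff p j * 0 ^ 0 else 0)) at_top"
    by (rule monomial_sum_tendsto[where g = "\<lambda>_. 0"]) auto
  moreover have "monomial_sum {..n} (coeff p) (\<lambda>i. i) (\<lambda>_. 0) s 0 = poly p s" for s
    using poly_altdef_le[OF assms, of s] by (simp add: monomial_sum_def)
  ultimately show ?thesis by simp
qed

section \<open>Polynomial functions of two variables\<close>

lemma real_polynomial_function_monomial_sum:
  fixes q :: "real \<times> real \<Rightarrow> real"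
  assumes "real_polynomial_function q"
  obtains S :: "(nat \<times> nat) set" and c where "finite S" "\<And>j. j \<in> S \<Longrightarrow> c j \<noteq> 0"
    "\<And>x y. q (x, y) = monomial_sum S c fst snd x y"
proof -
  \<comment> \<open>Here \<open>p\<close> is a polynomial in \<open>y\<close> with coefficients in
    the polynomials in \<open>x\<close>: the outer variable is evaluated first, at the constant
    polynomial \<open>[:y:]\<close>.\<close>
  have "\<exists>p. \<forall>x y. q (x, y) = poly (poly p [:y:]) x"
    using assms
  proof induction
    case (linear f)
    then interpret bounded_linear f .
    define u v where "u = f (1, 0)" and "v = f (0, 1)"
    have "f (x, y) = u * x + v * y" for x y
      using add[of "x *\<^sub>R (1, 0)" "y *\<^sub>R (0, 1)"] scaleR[of x "(1, 0)"] scaleR[of y "(0, 1)"]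
      by (simp add: u_def v_def)
    then show ?case
      by (intro exI[of _ "[:[:0, u:], [:v:]:]"]) simp
  next
    case (const c)
    show ?case by (intro exI[of _ "[:[:c:]:]"]) simp
  next
    case (add f g)
    then obtain p r where "\<forall>x y. f (x, y) = poly (poly p [:y:]) x" "\<forall>x y. g (x, y) = poly (poly r [:y:]) x"
      by blast
    then show ?case by (intro exI[of _ "p + r"]) simp
  next
    case (mult f g)
    then obtain p r where "\<forall>x y. f (x, y) = poly (poly p [:y:]) x" "\<forall>x y. g (x, y) = poly (poly r [:y:]) x"
      by blast
    then show ?case by (intro exI[of _ "p * r"]) simp
  qed
  then obtain p where p: "\<And>x y. q (x, y) = poly (poly p [:y:]) x" by blast
  define c where "c = (\<lambda>(i, k). coeff (coeff p k) i)"
  \<comment> \<open>A common bound for the degrees in \<open>x\<close> makes the index set a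
    rectangle; vanishing coefficients are discarded afterwards.\<close>
  define M where "M = Max ((\<lambda>k. degree (coeff p k)) ` {..degree p})"
  define B where "B = {..M} \<times> {..degree p}"
  have deg: "degree (coeff p k) \<le> M" if "k \<le> degree p" for k
    using that by (auto simp: M_def)
  have "q (x, y) = (\<Sum>k\<le>degree p. \<Sum>i\<le>M. c (i, k) * x ^ i * y ^ k)" for x y
  proof -
    have "q (x, y) = (\<Sum>k\<le>degree p. poly (coeff p k) x * y ^ k)"
      by (simp add: p poly_altdef[of p] poly_sum poly_power)
    also have "\<dots> = (\<Sum>k\<le>degree p. \<Sum>i\<le>M. c (i, k) * x ^ i * y ^ k)"
      by (intro sum.cong refl) (simp add: poly_altdef_le[OF deg] sum_distrib_right c_def)
    finally show ?thesis .
  qed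
  also have "(\<Sum>k\<le>degree p. \<Sum>i\<le>M. c (i, k) * x ^ i * y ^ k) = monomial_sum B c fst snd x y" for x y
    unfolding monomial_sum_def B_def
    by (subst sum.swap) (simp add: sum.cartesian_product case_prod_unfold)
  also have "monomial_sum B c fst snd x y = monomial_sum {j \<in> B. c j \<noteq> 0} c fst snd x y" for x y
    unfolding monomial_sum_def by (intro sum.mono_neutral_right) (auto simp: B_def)
  finally show ?thesis
    by (intro that[of "{j \<in> B. c j \<noteq> 0}" c]) (auto simp: B_def)
qed

section \<open>The differential equation of a commuting field\<close>

lemma poly_fst_has_derivative:
  "((\<lambda>p. poly F (fst p)) has_derivative (\<lambda>h. fst h * poly (pderiv F) (fst p))) (at p)"
  for F :: "real poly"
  using DERIV_compose_FDERIV[where f = "poly F" and g = fst and x = p and s = UNIV]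
    bounded_linear_imp_has_derivative[OF bounded_linear_fst] poly_DERIV by blast

lemma lienard_has_derivative:
  "(lienard F has_derivative (\<lambda>h. (snd h - poly (pderiv F) (fst p) * fst h, - fst h))) (at p)"
proof -
  have "lienard F = (\<lambda>p. (snd p - poly F (fst p), - fst p))"
    by (auto simp: lienard_def)
  then show ?thesis
    by (auto intro!: derivative_eq_intros poly_fst_has_derivative)
qed

text \<open>Since both components are differentiable, \<open>frechet_derivative\<close> is the true
  derivative, and the two coordinates of DX(L) = DL(X) can be compared.\<close>

lemma lie_bracket_lienard_eq_0D:
  assumes "lie_bracket (lienard F) X p = 0"
    and P: "((\<lambda>p. fst (X p)) has_derivative P') (at p)"
    and Q: "((\<lambda>p. snd (X p)) has_derivative Q') (at p)"
  shows "P' (lienard F p) = snd (X p) - poly (pderiv F) (fst p) * fst (X p)"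
    and "Q' (lienard F p) = - fst (X p)"
proof -
  have "(X has_derivative (\<lambda>h. (P' h, Q' h))) (at p)"
    using has_derivative_Pair[OF P Q] by simp
  then have "(P' (lienard F p), Q' (lienard F p))
      - (snd (X p) - poly (pderiv F) (fst p) * fst (X p), - fst (X p)) = 0"
    using assms(1) unfolding lie_bracket_def
    by (simp only: frechet_derivative_at[symmetric] flip: frechet_derivative_at[OF lienard_has_derivative])
  then show "P' (lienard F p) = snd (X p) - poly (pderiv F) (fst p) * fst (X p)"
    and "Q' (lienard F p) = - fst (X p)"
    by (simp_all add: prod_eq_iff)
qed

text \<open>The second coordinate of the bracket gives P = - L Q. Substituted into the first, it
  gives L(L Q) + F' L Q + Q = 0; \<open>?E\<close> is this written out, after the terms F' (y - F)
  Q_x cancel.\<close>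

lemma lienard_commuting_field:
  assumes br: "\<And>p. lie_bracket (lienard F) X p = 0"
    and diff: "\<And>p. X differentiable at p"
    and Q: "\<And>p. ((\<lambda>p. snd (X p)) has_derivative (\<lambda>h. fst h * Qx p + snd h * Qy p)) (at p)"
    and Qx: "\<And>p. (Qx has_derivative (\<lambda>h. fst h * Qxx p + snd h * Qxy p)) (at p)"
    and Qy: "\<And>p. (Qy has_derivative (\<lambda>h. fst h * Qxy p + snd h * Qyy p)) (at p)"
  shows "fst (X p) = - ((snd p - poly F (fst p)) * Qx p - fst p * Qy p)" (is ?P)
    and "(snd p - poly F (fst p))\<^sup>2 * Qxx p - 2 * fst p * (snd p - poly F (fst p)) * Qxy p
      + (fst p)\<^sup>2 * Qyy p - (snd p - poly F (fst p)) * Qy p - fst p * Qx p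
      - poly (pderiv F) (fst p) * fst p * Qy p + snd (X p) = 0" (is ?E)
proof -
  have L: "lienard F p = (snd p - poly F (fst p), - fst p)" for p
    by (simp add: lienard_def case_prod_unfold)
  have P: "fst (X p) = - ((snd p - poly F (fst p)) * Qx p - fst p * Qy p)" for p
  proof -
    \<comment> \<open>Some derivative of P must exist before the bracket can be read; the explicit
      one follows later from the formula for P.\<close>
    obtain P' where "((\<lambda>p. fst (X p)) has_derivative P') (at p)"
      using diff[of p] has_derivative_fst unfolding differentiable_def by blast
    from lie_bracket_lienard_eq_0D(2)[OF br this Q] show ?thesis
      by (simp add: L)
  qed
  then show ?P .
  have "((\<lambda>p. fst (X p)) has_derivative (\<lambda>h.
      - ((snd h - fst h * poly (pderiv F) (fst p)) * Qx p
         + (snd p - poly F (fst p)) * (fst h * Qxx p + snd h * Qxy p)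
         - (fst h * Qy p + fst p * (fst h * Qxy p + snd h * Qyy p))))) (at p)"
    unfolding P
    by (auto intro!: derivative_eq_intros poly_fst_has_derivative Qx Qy simp: algebra_simps)
  from lie_bracket_lienard_eq_0D(1)[OF br this Q] show ?E
    unfolding P L by (simp add: algebra_simps power2_eq_square)
qed

text \<open>The equation is multiplied by \<open>x\<^sup>2 y\<^sup>2\<close> so that all derivatives become sums over the same
  monomials with modified coefficients, avoiding truncated exponents.\<close>

lemma lienard_commuting_monomial_sum:
  fixes X :: "real \<times> real \<Rightarrow> real \<times> real" and c :: "nat \<times> nat \<Rightarrow> real"
  assumes br: "\<And>p. lie_bracket (lienard F) X p = 0"
    and diff: "\<And>p. X differentiable at p"
    and Q: "\<And>x y. snd (X (x, y)) = monomial_sum S c fst snd x y"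
  defines "M \<equiv> \<lambda>w. monomial_sum S (\<lambda>j. c j * w (real (fst j)) (real (snd j))) fst snd"
  shows "(y - poly F x)\<^sup>2 * y\<^sup>2 * M (\<lambda>i k. i * (i - 1)) x y
    - (y - poly F x) * x\<^sup>2 * y * M (\<lambda>i k. k) x y
    - 2 * (y - poly F x) * x\<^sup>2 * y * M (\<lambda>i k. i * k) x y
    - x\<^sup>2 * y\<^sup>2 * M (\<lambda>i k. i) x y
    + x ^ 4 * M (\<lambda>i k. k * (k - 1)) x y
    - poly (pderiv F) x * x ^ 3 * y * M (\<lambda>i k. k) x y
    + x\<^sup>2 * y\<^sup>2 * M (\<lambda>i k. 1) x y = 0"
proof -
  define N where "N = (\<lambda>w a b. monomial_sum S (\<lambda>j. c j * w (real (fst j)) (real (snd j)))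
      (\<lambda>j. fst j - a) (\<lambda>j. snd j - b) :: real \<Rightarrow> real \<Rightarrow> real)"
  have N: "N w 0 0 = M w" for w by (simp add: N_def M_def)
  \<comment> \<open>Natural and real subtraction agree here because the other factor vanishes where
    truncation occurs.\<close>
  have coeffs:
    "c j * real (fst j) * real (fst j - Suc 0) = c j * (real (fst j) * (real (fst j) - 1))"
    "c j * real (snd j) * real (snd j - Suc 0) = c j * (real (snd j) * (real (snd j) - 1))"
    "c j * real (fst j) * real (snd j) = c j * (real (fst j) * real (snd j))"
    "c j * real (snd j) * real (fst j) = c j * (real (fst j) * real (snd j))" for j
    by (cases "fst j"; cases "snd j"; simp)+
  have Q0: "(\<lambda>p. snd (X p)) = (\<lambda>p. monomial_sum S c fst snd (fst p) (snd p))"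
    by (simp add: fun_eq_iff Q)
  have 1: "((\<lambda>p. snd (X p)) has_derivative
      (\<lambda>h. fst h * N (\<lambda>i k. i) 1 0 (fst p) (snd p) + snd h * N (\<lambda>i k. k) 0 1 (fst p) (snd p))) (at p)" for p
    unfolding Q0 N_def by (rule has_derivative_eq_rhs[OF monomial_sum_has_derivative]) simp
  have 2: "((\<lambda>p. N (\<lambda>i k. i) 1 0 (fst p) (snd p)) has_derivative
      (\<lambda>h. fst h * N (\<lambda>i k. i * (i - 1)) 2 0 (fst p) (snd p)
         + snd h * N (\<lambda>i k. i * k) 1 1 (fst p) (snd p))) (at p)" for p
    unfolding N_def
    by (rule has_derivative_eq_rhs[OF monomial_sum_has_derivative])
      (simp add: coeffs numeral_2_eq_2)
  have 3: "((\<lambda>p. N (\<lambda>i k. k) 0 1 (fst p) (snd p)) has_derivative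
      (\<lambda>h. fst h * N (\<lambda>i k. i * k) 1 1 (fst p) (snd p)
         + snd h * N (\<lambda>i k. k * (k - 1)) 0 2 (fst p) (snd p))) (at p)" for p
    unfolding N_def
    by (rule has_derivative_eq_rhs[OF monomial_sum_has_derivative])
      (simp add: coeffs numeral_2_eq_2)
  have shift: "x\<^sup>2 * N (\<lambda>i k. i * (i - 1)) 2 0 x y = M (\<lambda>i k. i * (i - 1)) x y"
    "x * y * N (\<lambda>i k. i * k) 1 1 x y = M (\<lambda>i k. i * k) x y"
    "y\<^sup>2 * N (\<lambda>i k. k * (k - 1)) 0 2 x y = M (\<lambda>i k. k * (k - 1)) x y"
    "x * N (\<lambda>i k. i) 1 0 x y = M (\<lambda>i k. i) x y"
    "y * N (\<lambda>i k. k) 0 1 x y = M (\<lambda>i k. k) x y"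
  proof -
    have ge2: "i \<ge> 2" if "real i * (real i - 1) \<noteq> 0" for i
      using that by (cases "i = 0 \<or> i = 1") auto
    have *: "x ^ a * y ^ b * N w a b x y = M w x y"
      if "\<And>i k. w (real i) (real k) \<noteq> 0 \<Longrightarrow> a \<le> i \<and> b \<le> k" for w a b
      unfolding N_def M_def by (rule monomial_sum_shift) (use that in auto)
    show "x\<^sup>2 * N (\<lambda>i k. i * (i - 1)) 2 0 x y = M (\<lambda>i k. i * (i - 1)) x y"
      using *[of "\<lambda>i k. i * (i - 1)" 2 0, OF conjI[OF ge2]] by simp
    show "x * y * N (\<lambda>i k. i * k) 1 1 x y = M (\<lambda>i k. i * k) x y"
      using *[of "\<lambda>i k. i * k" 1 1] by (simp add: Suc_le_eq)
    show "y\<^sup>2 * N (\<lambda>i k. k * (k - 1)) 0 2 x y = M (\<lambda>i k. k * (k - 1)) x y"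
      using *[of "\<lambda>i k. k * (k - 1)" 0 2, OF conjI[OF _ ge2]] by simp
    show "x * N (\<lambda>i k. i) 1 0 x y = M (\<lambda>i k. i) x y"
      using *[of "\<lambda>i k. i" 1 0] by (simp add: Suc_le_eq)
    show "y * N (\<lambda>i k. k) 0 1 x y = M (\<lambda>i k. k) x y"
      using *[of "\<lambda>i k. k" 0 1] by (simp add: Suc_le_eq)
  qed
  note E = lienard_commuting_field(2)[OF br diff 1 2 3, of "(x, y)", unfolded fst_conv snd_conv]
  have Q1: "snd (X (x, y)) = M (\<lambda>i k. 1) x y" by (simp add: Q M_def)
  have E': "x\<^sup>2 * y\<^sup>2 * ((y - poly F x)\<^sup>2 * N (\<lambda>i k. i * (i - 1)) 2 0 x y
      - 2 * x * (y - poly F x) * N (\<lambda>i k. i * k) 1 1 x y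
      + x\<^sup>2 * N (\<lambda>i k. k * (k - 1)) 0 2 x y
      - (y - poly F x) * N (\<lambda>i k. k) 0 1 x y - x * N (\<lambda>i k. i) 1 0 x y
      - poly (pderiv F) x * x * N (\<lambda>i k. k) 0 1 x y + M (\<lambda>i k. 1) x y) = 0"
    by (simp only: E[unfolded Q1] mult_zero_right)
  have expand: "u\<^sup>2 * y\<^sup>2 * (x\<^sup>2 * qxx) - u * x\<^sup>2 * y * (y * qy) - 2 * u * x\<^sup>2 * y * (x * y * qxy)
      - x\<^sup>2 * y\<^sup>2 * (x * qx) + x ^ 4 * (y\<^sup>2 * qyy) - f * x ^ 3 * y * (y * qy) + x\<^sup>2 * y\<^sup>2 * q
    = x\<^sup>2 * y\<^sup>2 * (u\<^sup>2 * qxx - 2 * x * u * qxy + x\<^sup>2 * qyy - u * qy - x * qx - f * x * qy + q)"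
    for u f q qx qy qxx qxy qyy :: real
    by algebra
  show ?thesis
    unfolding shift[symmetric] expand by (rule E')
qed

section \<open>The case of degree one\<close>

lemma linear_lienard_no_closed_orbit:
  assumes deg: "degree F = 1" and "closed_orbit (lienard F) S"
  shows False
proof -
  obtain \<gamma> T where \<gamma>: "integral_curve (lienard F) \<gamma>" and T: "T > 0" and per: "\<And>t. \<gamma> (t + T) = \<gamma> t"
    and nc: "\<not> \<gamma> constant_on UNIV"
    using assms by (auto simp: closed_orbit_def)
  obtain b a where F: "F = [:b, a:]" and a: "a \<noteq> 0"
    using degree1_coeffs[OF deg] by metis
  define x y where "x = (\<lambda>t. fst (\<gamma> t))" and "y = (\<lambda>t. snd (\<gamma> t))"
  have D: "(\<gamma> has_vector_derivative (y t - (b + a * x t), - x t)) (at t)" for t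
    using \<gamma> by (simp add: integral_curve_def lienard_def case_prod_unfold x_def y_def F mult.commute)
  have x: "(x has_real_derivative (y t - (b + a * x t))) (at t)" for t
    using has_derivative_fst[OF D[of t, unfolded has_vector_derivative_def]]
    by (simp add: x_def has_field_derivative_def mult_commute_abs)
  have y: "(y has_real_derivative (- x t)) (at t)" for t
    using has_derivative_snd[OF D[of t, unfolded has_vector_derivative_def]]
    by (auto simp: y_def has_field_derivative_def elim!: has_derivative_eq_rhs)
  \<comment> \<open>The factor \<open>- 1 / (2 * a)\<close> makes the derivative exactly
    \<open>(x t)\<^sup>2\<close>, whatever the sign of \<open>a\<close>.\<close>
  define V where "V = (\<lambda>t. - ((x t)\<^sup>2 + (y t - b)\<^sup>2) / (2 * a))"
  have V: "(V has_real_derivative (x t)\<^sup>2) (at t)" for t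
    unfolding V_def using a
    by (auto intro!: derivative_eq_intros x y simp: field_simps power2_eq_square)
  have mono: "V s \<le> V t" if "s \<le> t" for s t
    using DERIV_nonneg_imp_nondecreasing[OF that] V by (metis zero_le_power2)
  have perV: "V (t + real k * T) = V t" for t k
  proof (induction k)
    case (Suc k)
    have "V (t + real (Suc k) * T) = V ((t + real k * T) + T)" by (simp add: algebra_simps)
    also have "\<dots> = V (t + real k * T)" by (simp only: V_def x_def y_def per)
    finally show ?case using Suc by simp
  qed simp
  have const: "V s = V t" if "s \<le> t" for s t
  proof -
    \<comment> \<open>A nondecreasing periodic function is constant: shifting \<open>s\<close> past
      \<open>t\<close> by whole periods bounds \<open>V t\<close> by \<open>V s\<close>.\<close>
    obtain k :: nat where "t - s < real k * T" using T reals_Archimedean3 by blast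
    then have "V t \<le> V (s + real k * T)" by (intro mono) simp
    with perV mono[OF that] show ?thesis by simp
  qed
  have "V = (\<lambda>_. V 0)" by (rule ext) (metis const linear)
  then have "(x t)\<^sup>2 = 0" for t
    using V[of t] DERIV_const[of "V 0" "at t"] DERIV_unique by metis
  then have x0: "x = (\<lambda>_. 0)" by auto
  have "y t = b" for t
  proof -
    have "((\<lambda>_. 0) has_real_derivative y t - b) (at t)"
      using x[of t] by (simp add: x0)
    then show ?thesis
      using DERIV_unique[OF _ DERIV_const] by fastforce
  qed
  with x0 have "\<gamma> t = (0, b)" for t
    by (metis prod.collapse x_def y_def)
  then have "\<gamma> constant_on UNIV" by (auto simp: constant_on_def)
  with nc show False ..
qed

section \<open>Top-weight analysis in degree at least two\<close>

text \<open>Leading terms are extracted by limits along curves \<open>(s, g s)\<close> instead of by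
  comparing coefficients. The constant monomial stays in the conclusion because the argument fixes
  only the top weight.\<close>

lemma lienard_weights_le_1:
  fixes S :: "(nat \<times> nat) set" and c :: "nat \<times> nat \<Rightarrow> real"
  defines "M \<equiv> \<lambda>w. monomial_sum S (\<lambda>j. c j * w (real (fst j)) (real (snd j))) fst snd"
  assumes fin: "finite S" and c: "\<And>j. j \<in> S \<Longrightarrow> c j \<noteq> 0"
    and n: "degree F \<ge> 2"
    and pde: "\<And>x y. (y - poly F x)\<^sup>2 * y\<^sup>2 * M (\<lambda>i k. i * (i - 1)) x y
      - (y - poly F x) * x\<^sup>2 * y * M (\<lambda>i k. k) x y
      - 2 * (y - poly F x) * x\<^sup>2 * y * M (\<lambda>i k. i * k) x y
      - x\<^sup>2 * y\<^sup>2 * M (\<lambda>i k. i) x y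
      + x ^ 4 * M (\<lambda>i k. k * (k - 1)) x y
      - poly (pderiv F) x * x ^ 3 * y * M (\<lambda>i k. k) x y
      + x\<^sup>2 * y\<^sup>2 * M (\<lambda>i k. 1) x y = 0"
  shows "S \<subseteq> {(0, 0), (1, 0)}"
proof (cases "S = {}")
  case False
  define n a where "n = degree F" and "a = lead_coeff F"
  have n2: "n \<ge> 2" and a: "a \<noteq> 0"
    using n by (auto simp: n_def a_def)
  define wt where "wt = (\<lambda>j::nat \<times> nat. fst j + n * snd j)"
  define N where "N = Max (wt ` S)"
  have wt_le: "wt j \<le> N" if "j \<in> S" for j
    using that fin by (simp add: N_def)
  obtain j0 where j0: "j0 \<in> S" "wt j0 = N"
    using Max_in[of "wt ` S"] fin False unfolding N_def by fastforce
  \<comment> \<open>\<open>T w \<eta>\<close> is the top-weight component of \<open>M w\<close> at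
    \<open>(1, \<eta>)\<close>.\<close>
  define T where "T = (\<lambda>w \<eta>. \<Sum>j\<in>S. if wt j = N
      then c j * w (real (fst j)) (real (snd j)) * \<eta> ^ snd j else 0 :: real)"
  have M: "((\<lambda>s. M w s (g s) / s ^ N) \<longlongrightarrow> T w \<eta>) at_top"
    if "((\<lambda>s. g s / s ^ n) \<longlongrightarrow> \<eta>) at_top" for w g \<eta>
    using monomial_sum_tendsto[OF _ that, of S fst snd N] wt_le by (simp add: M_def T_def wt_def)
  have F: "((\<lambda>s. poly F s / s ^ n) \<longlongrightarrow> a) at_top"
    using poly_over_power_tendsto[of F n] by (simp add: n_def a_def)
  have F': "((\<lambda>s. s * poly (pderiv F) s / s ^ n) \<longlongrightarrow> n * a) at_top"
  proof -
    have "degree (pCons 0 (pderiv F)) \<le> n"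
      using n2 by (simp add: degree_pCons_eq_if degree_pderiv n_def)
    moreover have "coeff (pCons 0 (pderiv F)) n = n * a"
      using n2 by (cases n) (auto simp: coeff_pderiv a_def simp flip: n_def)
    ultimately show ?thesis
      using poly_over_power_tendsto[of "pCons 0 (pderiv F)" n] by simp
  qed
  \<comment> \<open>\<open>E g s\<close> is the equation at \<open>(s, g s)\<close> divided by \<open>s ^ (N + 4 * n)\<close>; its part \<open>r s * I g s\<close> is negligible
    off the curve \<open>y = F x\<close>, while on the curve it is all that remains.\<close>
  define r where "r = (\<lambda>s::real. (s / s ^ n)\<^sup>2)"
  \<comment> \<open>This is where \<open>n \<ge> 2\<close> separates the orders; for
    \<open>n = 1\<close> the function would be constantly 1 for positive \<open>s\<close>.\<close>
  have r: "(r \<longlongrightarrow> 0) at_top"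
  proof -
    have "((\<lambda>s::real. s / s ^ n) \<longlongrightarrow> 0) at_top"
      using poly_over_power_tendsto[of "[:0, 1:]" n] n2
      by (simp add: coeff_pCons split: nat.split_asm nat.splits)
    from tendsto_power[OF this, of 2] show ?thesis by (simp add: r_def)
  qed
  define I where "I = (\<lambda>g s. r s * (M (\<lambda>i k. k * (k - 1)) s (g s) / s ^ N)
      - ((g s - poly F s) / s ^ n) * (g s / s ^ n) * (M (\<lambda>i k. k) s (g s) / s ^ N)
      - 2 * ((g s - poly F s) / s ^ n) * (g s / s ^ n) * (M (\<lambda>i k. i * k) s (g s) / s ^ N)
      - (g s / s ^ n)\<^sup>2 * (M (\<lambda>i k. i) s (g s) / s ^ N)
      - (s * poly (pderiv F) s / s ^ n) * (g s / s ^ n) * (M (\<lambda>i k. k) s (g s) / s ^ N)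
      + (g s / s ^ n)\<^sup>2 * (M (\<lambda>i k. 1) s (g s) / s ^ N))"
  define E where "E = (\<lambda>g s. ((g s - poly F s) / s ^ n)\<^sup>2 * (g s / s ^ n)\<^sup>2
      * (M (\<lambda>i k. i * (i - 1)) s (g s) / s ^ N) + r s * I g s)"
  have E_0: "E g s = 0" if "s > 0" for s g
  proof -
    have "(u / d)\<^sup>2 * (y / d)\<^sup>2 * (A / e) + (s / d)\<^sup>2 * ((s / d)\<^sup>2 * (H / e)
        - u / d * (y / d) * (B / e) - 2 * (u / d) * (y / d) * (C / e) - (y / d)\<^sup>2 * (D / e)
        - s * f / d * (y / d) * (B / e) + (y / d)\<^sup>2 * (G / e))
      = (u\<^sup>2 * y\<^sup>2 * A - u * s\<^sup>2 * y * B - 2 * u * s\<^sup>2 * y * C - s\<^sup>2 * y\<^sup>2 * D + s ^ 4 * H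
        - f * s ^ 3 * y * B + s\<^sup>2 * y\<^sup>2 * G) / (d ^ 4 * e)"
      for u d y e f A B C D G H :: real
      by (simp only: divide_inverse inverse_mult_distrib power_inverse[symmetric]) algebra
    then show ?thesis
      unfolding E_def I_def r_def by (simp only: pde div_0)
  qed
  \<comment> \<open>The limit of \<open>I g\<close> when \<open>g s / s ^ n\<close> tends to
    \<open>\<eta>\<close>; the leading 0 is the limit of \<open>r\<close>.\<close>
  define L where "L = (\<lambda>\<eta>. 0 * T (\<lambda>i k. k * (k - 1)) \<eta>
      - (\<eta> - a) * \<eta> * T (\<lambda>i k. k) \<eta> - 2 * (\<eta> - a) * \<eta> * T (\<lambda>i k. i * k) \<eta>
      - \<eta>\<^sup>2 * T (\<lambda>i k. i) \<eta> - n * a * \<eta> * T (\<lambda>i k. k) \<eta> + \<eta>\<^sup>2 * T (\<lambda>i k. 1) \<eta>)"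
  have I: "(I g \<longlongrightarrow> L \<eta>) at_top" if g: "((\<lambda>s. g s / s ^ n) \<longlongrightarrow> \<eta>) at_top" for g \<eta>
    unfolding I_def L_def diff_divide_distrib by (intro tendsto_intros M[OF g] r F F' g)
  have E: "(E g \<longlongrightarrow> (\<eta> - a)\<^sup>2 * \<eta>\<^sup>2 * T (\<lambda>i k. i * (i - 1)) \<eta> + 0 * L \<eta>) at_top"
    if g: "((\<lambda>s. g s / s ^ n) \<longlongrightarrow> \<eta>) at_top" for g \<eta>
    unfolding E_def diff_divide_distrib by (intro tendsto_intros M[OF g] r F I g)
  have eq_0: "l = 0" if "(h \<longlongrightarrow> l) at_top" "\<And>s. s > 0 \<Longrightarrow> h s = 0" for h :: "real \<Rightarrow> real" and l
  proof -
    have "((\<lambda>_::real. 0) \<longlongrightarrow> l) at_top"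
    proof (rule Lim_transform_eventually[OF that(1)])
      show "\<forall>\<^sub>F s in at_top. h s = 0"
        using eventually_mono[OF eventually_gt_at_top that(2)] .
    qed
    then show ?thesis by (simp add: tendsto_const_iff)
  qed
  have top: "fst j * (fst j - 1) = 0" if j: "j \<in> S" "wt j = N" for j
  proof -
    \<comment> \<open>The top-weight part of \<open>x\<^sup>2\<close> times the second
      \<open>x\<close>-derivative, at \<open>x = 1\<close>, as a polynomial in
      \<open>\<eta>\<close>. The curves \<open>y = \<eta> * s ^ n\<close> show that it vanishes for
      every \<open>\<eta>\<close> except possibly 0 and \<open>a\<close>.\<close>
    define R where "R = (\<Sum>j\<in>S. if wt j = N
        then monom (c j * (real (fst j) * (real (fst j) - 1))) (snd j) else 0)"
    have poly_R: "poly R \<eta> = T (\<lambda>i k. i * (i - 1)) \<eta>" for \<eta>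
      unfolding R_def T_def poly_sum by (intro sum.cong refl) (simp add: poly_monom)
    have zero: "T (\<lambda>i k. i * (i - 1)) \<eta> = 0" if \<eta>: "\<eta> \<notin> {0, a}" for \<eta>
    proof -
      have g: "((\<lambda>s::real. \<eta> * s ^ n / s ^ n) \<longlongrightarrow> \<eta>) at_top"
        by (rule Lim_transform_eventually[OF tendsto_const])
          (use eventually_gt_at_top[of 0] in eventually_elim, simp)
      have "(\<eta> - a)\<^sup>2 * \<eta>\<^sup>2 * T (\<lambda>i k. i * (i - 1)) \<eta> + 0 * L \<eta> = 0"
        by (rule eq_0[OF E[OF g] E_0])
      with \<eta> show ?thesis by simp
    qed
    have "R = 0"
    proof (rule ccontr)
      assume "R \<noteq> 0"
      then have "finite {\<eta>. poly R \<eta> = 0}" by (rule poly_roots_finite)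
      then have "finite ({\<eta>. poly R \<eta> = 0} \<union> {0, a})" by simp
      moreover have "{\<eta>. poly R \<eta> = 0} \<union> {0, a} = UNIV"
        using zero by (auto simp: poly_R)
      ultimately show False
        using infinite_UNIV_char_0[where 'a = real] by (simp only:)
    qed
    \<comment> \<open>At fixed weight the exponent of \<open>y\<close> determines that of
      \<open>x\<close>, so this coefficient isolates \<open>j\<close>.\<close>
    have "coeff R (snd j) = (\<Sum>j'\<in>S. if j' = j then c j * (real (fst j) * (real (fst j) - 1)) else 0)"
      unfolding R_def coeff_sum using j by (intro sum.cong refl) (auto simp: wt_def prod_eq_iff)
    then have "c j * (real (fst j) * (real (fst j) - 1)) = 0"
      using \<open>R = 0\<close> j fin by simp
    with c[OF j(1)] show ?thesis by auto
  qed
  have unique: "j = j0" if j: "j \<in> S" "wt j = N" for j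
  proof -
    have "fst j \<le> 1" "fst j0 \<le> 1"
      using top[OF j] top[OF j0] by auto
    \<comment> \<open>Since exponents of \<open>x\<close> are at most 1 and
      \<open>n \<ge> 2\<close>, the residue of the weight modulo \<open>n\<close> recovers
      them.\<close>
    then have "wt j mod n = fst j" "wt j0 mod n = fst j0"
      using n2 by (simp_all add: wt_def)
    then have fst_eq: "fst j = fst j0" using j j0 by metis
    have "fst j + n * snd j = fst j0 + n * snd j0"
      using j(2) j0(2) unfolding wt_def by (rule trans[OF _ sym])
    then have "n * snd j = n * snd j0"
      unfolding fst_eq by (rule add_left_imp_eq)
    moreover have "0 < n" using n2 by simp
    ultimately have "snd j = snd j0"
      using nat_mult_eq_cancel1 by blast
    with fst_eq show ?thesis by (rule prod_eqI)
  qed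
  have T: "T w \<eta> = c j0 * w (real (fst j0)) (real (snd j0)) * \<eta> ^ snd j0" for w \<eta>
  proof -
    have "wt j = N \<longleftrightarrow> j = j0" if "j \<in> S" for j
      using unique[OF that] j0(2) by blast
    then have "T w \<eta> = (\<Sum>j\<in>S. if j = j0 then c j0 * w (real (fst j0)) (real (snd j0)) * \<eta> ^ snd j0 else 0)"
      unfolding T_def by (intro sum.cong refl) simp
    then show ?thesis using j0 fin by simp
  qed
  \<comment> \<open>On the curve \<open>y = poly F s\<close> the squared factor is exactly zero, so
    the nonzero \<open>r s\<close> can be divided out before taking the limit.\<close>
  have "L a = 0"
  proof (rule eq_0[OF I[OF F]])
    fix s :: real assume "s > 0"
    then have "r s \<noteq> 0" by (simp add: r_def)
    with E_0[OF \<open>s > 0\<close>, of "poly F"] show "I (poly F) s = 0" by (simp add: E_def)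
  qed
  \<comment> \<open>The terms with \<open>\<eta> - a\<close> drop out, and the rest combine into the
    weight as in Euler's identity.\<close>
  moreover have "L a = a\<^sup>2 * (c j0 * a ^ snd j0) * (1 - real (wt j0))"
    unfolding L_def T wt_def by (simp add: algebra_simps power2_eq_square)
  ultimately have "N = 1"
    using a c[OF j0(1)] j0(2) by simp
  then have "j \<in> {(0, 0), (1, 0)}" if "j \<in> S" for j
  proof -
    have le: "fst j + n * snd j \<le> 1" using wt_le[OF that] \<open>N = 1\<close> by (simp add: wt_def)
    have "snd j = 0"
    proof (rule ccontr)
      assume "snd j \<noteq> 0"
      then have "n * 1 \<le> n * snd j" by (intro mult_le_mono2) simp
      with le n2 show False by simp
    qed
    with le show ?thesis by (cases j) auto
  qed
  then show ?thesis by blast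
qed simp

section \<open>Identification of the commuting field\<close>

theorem mainTheorem3:
  fixes F :: "real poly" and X :: "real \<times> real \<Rightarrow> real \<times> real"
  assumes "degree F \<ge> 1"
    and "\<exists>S. closed_orbit (lienard F) S"
    and "polynomial_function X"
    and "\<forall>p. lie_bracket (lienard F) X p = 0"
  shows "\<exists>c::real. \<forall>p. X p = c *\<^sub>R lienard F p"
proof -
  have br: "lie_bracket (lienard F) X p = 0" for p using assms(4) by blast
  have diff: "X differentiable at p" for p
    using assms(3) by (rule differentiable_at_polynomial_function)
  have "degree F \<noteq> 1"
    using linear_lienard_no_closed_orbit assms(2) by blast
  with assms(1) have n: "degree F \<ge> 2" by simp
  have "real_polynomial_function (\<lambda>p. snd (X p))"
    using assms(3) bounded_linear_snd unfolding polynomial_function_def o_def by blast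
  then obtain S :: "(nat \<times> nat) set" and c where fin: "finite S" and c: "\<And>j. j \<in> S \<Longrightarrow> c j \<noteq> 0"
    and Q: "\<And>x y. snd (X (x, y)) = monomial_sum S c fst snd x y"
    by (rule real_polynomial_function_monomial_sum) (use that in blast)
  have S: "S \<subseteq> {(0, 0), (1, 0)}"
    using lienard_weights_le_1[OF fin c n lienard_commuting_monomial_sum[OF br diff Q]] .
  \<comment> \<open>Extension of \<open>c\<close> by zero, as \<open>S\<close> may miss either
    index.\<close>
  define d where "d = (\<lambda>j. if j \<in> S then c j else 0)"
  have "snd (X (x, y)) = (\<Sum>j\<in>{(0, 0), (1, 0)}. d j * x ^ fst j * y ^ snd j)" for x y
    unfolding Q monomial_sum_def by (rule sum.mono_neutral_cong_left) (use S in \<open>auto simp: d_def\<close>)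
  then have Q': "snd (X p) = d (0, 0) + d (1, 0) * fst p" for p
    by (cases p) simp
  have "((\<lambda>p. snd (X p)) has_derivative (\<lambda>h. fst h * d (1, 0) + snd h * 0)) (at p)" for p
    unfolding Q' by (auto intro!: derivative_eq_intros)
  note field = lienard_commuting_field[OF br diff this,
      where Qxx = "\<lambda>_. 0" and Qxy = "\<lambda>_. 0" and Qyy = "\<lambda>_. 0"]
  \<comment> \<open>At the origin every term of the equation vanishes except Q itself, because the
    \<open>y\<close>-derivative of Q is zero.\<close>
  have "d (0, 0) = 0" using field(2)[of "(0, 0)"] by (simp add: Q')
  then have "X p = (- d (1, 0)) *\<^sub>R lienard F p" for p
    using field(1)[of p] Q'[of p] by (simp add: prod_eq_iff lienard_def case_prod_unfold)
  then show ?thesis by blast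
qed

end
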